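(* The Gurariĭ space is unique up to a bijective isometry: if $E$ and $F$ are Gurariĭ spaces, then there exists a bijective isometry $h\colon E\to F$.
   Context: All Banach spaces are over one fixed scalar field (real or complex), the same for all spaces. Isometry: a linear operator $f\colon X\to Y$ between Banach spaces such that $\|f(x)\|=\|x\|$ for every $x\in X$; it is not assumed to be surjective. Gurariĭ space: a separable Banach space $\mathbb{G}$ such that, given finite dimensional Banach spaces $X\subseteq Y$ ($X$ a linear subspace of $Y$ with the inherited norm), given $\varepsilon>0$, and given an isometry (isometric linear embedding) $f\colon X\to\mathbb{G}$, there exists an injective linear operator $g\colon Y\to\mathbb{G}$ extending $f$ and satisfying $\|g\|\cdot\|g^{-1}\|<1+\varepsilon$, where $g^{-1}$ is the inverse of $g$ defined on $g[Y]$ and norms of operators are operator norms. *)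

theory Defs
  imports "HOL-Analysis.Analysis" "HOL-Library.Function_Algebras"
begin

text \<open>
  A normed space over a scalar field 'k is a type of class real_normed_vector together with a
  scalar multiplication by 'k extending the built-in real one.  For real scalars this is just
  scaleR; for complex scalars there is no type class, so the multiplication is a parameter.
\<close>

locale scaled_normed_space = vector_space scale
  for scale :: "'k::real_normed_field \<Rightarrow> 'a::real_normed_vector \<Rightarrow> 'a" +
  assumes norm_scale: "norm (scale c x) = norm c * norm x"
    and scale_of_real: "scale (of_real r) x = r *\<^sub>R x"

lemma scaled_normed_space_scaleR:
  "scaled_normed_space (scaleR :: real \<Rightarrow> 'a::real_normed_vector \<Rightarrow> 'a)"
  by unfold_locales (auto simp: algebra_simps)

definition norm_on ::
  "('k::real_normed_field \<Rightarrow> 'u::ab_group_add \<Rightarrow> 'u) \<Rightarrow> 'u set \<Rightarrow> ('u \<Rightarrow> real) \<Rightarrow> bool" where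
  "norm_on s V N \<longleftrightarrow>
     (\<forall>x\<in>V. 0 \<le> N x \<and> (N x = 0 \<longleftrightarrow> x = 0)) \<and>
     (\<forall>c. \<forall>x\<in>V. N (s c x) = norm c * N x) \<and>
     (\<forall>x\<in>V. \<forall>y\<in>V. N (x + y) \<le> N x + N y)"

text \<open>Completeness is automatic here: the spaces are finite dimensional and the definition is
  only used over the real and complex numbers.\<close>

definition finite_dim_normed_space ::
  "('k::real_normed_field \<Rightarrow> 'u::ab_group_add \<Rightarrow> 'u) \<Rightarrow> 'u set \<Rightarrow> ('u \<Rightarrow> real) \<Rightarrow> bool" where
  "finite_dim_normed_space s V N \<longleftrightarrow>
     module.subspace s V \<and> (\<exists>B. finite B \<and> V = module.span s B) \<and> norm_on s V N"

definition linear_map_on ::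
  "'u::ab_group_add set \<Rightarrow> ('k::field \<Rightarrow> 'u \<Rightarrow> 'u) \<Rightarrow> ('k \<Rightarrow> 'v::ab_group_add \<Rightarrow> 'v) \<Rightarrow>
     ('u \<Rightarrow> 'v) \<Rightarrow> bool" where
  "linear_map_on V s t f \<longleftrightarrow>
     (\<forall>x\<in>V. \<forall>y\<in>V. f (x + y) = f x + f y) \<and> (\<forall>c. \<forall>x\<in>V. f (s c x) = t c (f x))"

definition isometry_on ::
  "'u::ab_group_add set \<Rightarrow> ('k::field \<Rightarrow> 'u \<Rightarrow> 'u) \<Rightarrow> ('u \<Rightarrow> real) \<Rightarrow>
     ('k \<Rightarrow> 'v::ab_group_add \<Rightarrow> 'v) \<Rightarrow> ('v \<Rightarrow> real) \<Rightarrow> ('u \<Rightarrow> 'v) \<Rightarrow> bool" where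
  "isometry_on V s N t M f \<longleftrightarrow> linear_map_on V s t f \<and> (\<forall>x\<in>V. M (f x) = N x)"

text \<open>Operator norm of a map from (V, N) to a space normed by M, in the style of onorm: the
  quotient at 0 is 0 / 0 = 0.  It is meant for bounded operators on a linear subspace V.\<close>

definition onorm_on :: "'u set \<Rightarrow> ('u \<Rightarrow> real) \<Rightarrow> ('v \<Rightarrow> real) \<Rightarrow> ('u \<Rightarrow> 'v) \<Rightarrow> real" where
  "onorm_on V N M f = (SUP x\<in>V. M (f x) / N x)"

definition fscale :: "'k::field \<Rightarrow> (nat \<Rightarrow> 'k) \<Rightarrow> nat \<Rightarrow> 'k" where
  "fscale c x = (\<lambda>i. c * x i)"

global_interpretation fscale: vector_space fscale
  by unfold_locales (auto simp: fscale_def fun_eq_iff algebra_simps)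

text \<open>
  A definition cannot quantify over all types, so the finite dimensional spaces X and Y below
  are subspaces of the space of all scalar sequences, normed arbitrarily.  Up to isometry this
  covers all finite dimensional normed spaces; the extension property for test spaces living in
  any vector space is derived in the lemma gurarii_extension.
\<close>

definition gurarii :: "('k::real_normed_field \<Rightarrow> 'a::banach \<Rightarrow> 'a) \<Rightarrow> bool" where
  "gurarii s \<longleftrightarrow>
     scaled_normed_space s \<and> separable_space (euclidean :: 'a topology) \<and>
     (\<forall>(Y :: (nat \<Rightarrow> 'k) set) N X \<epsilon> f.
        finite_dim_normed_space fscale Y N \<and> fscale.subspace X \<and> X \<subseteq> Y \<and> \<epsilon> > 0 \<and>
        isometry_on X fscale N s norm f \<longrightarrow>
        (\<exists>g. linear_map_on Y fscale s g \<and> inj_on g Y \<and> (\<forall>x\<in>X. g x = f x) \<and>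
             onorm_on Y N norm g * onorm_on (g ` Y) norm N (inv_into Y g) < 1 + \<epsilon>))"

lemma finite_dim_coordinates:
  fixes t :: "'k::field \<Rightarrow> 'u::ab_group_add \<Rightarrow> 'u"
  assumes t: "vector_space t" and fin: "finite B" and Y: "Y = module.span t B"
  shows "\<exists>\<phi>. linear_map_on Y t fscale \<phi> \<and> inj_on \<phi> Y"
proof -
  interpret t: vector_space t by (fact t)
  obtain C where C: "C \<subseteq> B" "t.independent C" "t.span C = Y"
    using t.basis_exists[of B] Y by (metis t.span_mono t.span_span subset_antisym)
  have finC: "finite C" using C(1) fin finite_subset by blast
  obtain e where e: "bij_betw e {..<card C} C"
    using ex_bij_betw_nat_finite[OF finC] by (auto simp: atLeast0LessThan)
  define \<phi> where "\<phi> x = (\<lambda>i. if i < card C then t.representation C x (e i) else 0)" for x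
  have "linear_map_on Y t fscale \<phi>"
    unfolding linear_map_on_def \<phi>_def fscale_def
    using C by (auto simp: fun_eq_iff t.representation_add t.representation_scale)
  moreover have "inj_on \<phi> Y"
  proof (rule inj_onI)
    fix x y assume xy: "x \<in> Y" "y \<in> Y" "\<phi> x = \<phi> y"
    have r: "t.representation C x b = t.representation C y b" if "b \<in> C" for b
    proof -
      have "b \<in> e ` {..<card C}" using bij_betw_imp_surj_on[OF e] that by simp
      then obtain i where i: "i < card C" "b = e i" by auto
      then show ?thesis using fun_cong[OF xy(3), of i] by (simp add: \<phi>_def)
    qed
    have "x = (\<Sum>b\<in>C. t (t.representation C x b) b)"
      using t.sum_representation_eq[OF C(2) _ finC subset_refl] xy(1) C(3) by simp
    also have "\<dots> = (\<Sum>b\<in>C. t (t.representation C y b) b)" using r by simp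
    also have "\<dots> = y"
      using t.sum_representation_eq[OF C(2) _ finC subset_refl] xy(2) C(3) by simp
    finally show "x = y" .
  qed
  ultimately show ?thesis by blast
qed

lemma linear_map_on_subspace_image:
  assumes s: "vector_space s" and t: "vector_space t" and V: "module.subspace s V"
    and f: "linear_map_on V s t f"
  shows "module.subspace t (f ` V)"
proof -
  interpret s: vector_space s by (fact s)
  interpret t: vector_space t by (fact t)
  have f0: "f 0 = 0"
    using f s.subspace_0[OF V] unfolding linear_map_on_def
    by (metis s.scale_zero_left t.scale_zero_left)
  show ?thesis
  proof (rule t.subspaceI)
    show "0 \<in> f ` V" using f0 s.subspace_0[OF V] by (metis imageI)
    show "x + y \<in> f ` V" if "x \<in> f ` V" "y \<in> f ` V" for x y
    proof -
      from that obtain v w where vw: "v \<in> V" "w \<in> V" "x = f v" "y = f w" by blast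
      then have "x + y = f (v + w)" using f by (simp add: linear_map_on_def)
      then show ?thesis using s.subspace_add[OF V vw(1,2)] by blast
    qed
    show "t c x \<in> f ` V" if "x \<in> f ` V" for c x
    proof -
      from that obtain v where v: "v \<in> V" "x = f v" by blast
      then have "t c x = f (s c v)" using f by (simp add: linear_map_on_def)
      then show ?thesis using s.subspace_scale[OF V v(1)] by blast
    qed
  qed
qed

lemma linear_map_on_inv_into:
  assumes s: "vector_space s" and V: "module.subspace s V"
    and f: "linear_map_on V s t f" and inj: "inj_on f V"
  shows "linear_map_on (f ` V) t s (inv_into V f)"
proof -
  interpret s: vector_space s by (fact s)
  have "inv_into V f (f x + f y) = x + y" if "x \<in> V" "y \<in> V" for x y
    using that f inj s.subspace_add[OF V that] unfolding linear_map_on_def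
    by (metis inv_into_f_f)
  moreover have "inv_into V f (t c (f x)) = s c x" if "x \<in> V" for c x
    using that f inj s.subspace_scale[OF V that] unfolding linear_map_on_def
    by (metis inv_into_f_f)
  ultimately show ?thesis
    unfolding linear_map_on_def using inj by (auto simp: inv_into_f_f)
qed

lemma linear_map_on_compose:
  assumes "linear_map_on V s t f" "linear_map_on W t u g" "f ` V \<subseteq> W"
  shows "linear_map_on V s u (g \<circ> f)"
  using assms unfolding linear_map_on_def by (auto simp: image_subset_iff)

lemma gurarii_extension:
  fixes s :: "'k::real_normed_field \<Rightarrow> 'a::banach \<Rightarrow> 'a"
    and t :: "'k \<Rightarrow> 'u::ab_group_add \<Rightarrow> 'u"
  assumes G: "gurarii s" and t: "vector_space t" and Y: "finite_dim_normed_space t Y N"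
    and X: "module.subspace t X" "X \<subseteq> Y" and eps: "\<epsilon> > 0" and f: "isometry_on X t N s norm f"
  shows "\<exists>g. linear_map_on Y t s g \<and> inj_on g Y \<and> (\<forall>x\<in>X. g x = f x) \<and>
             onorm_on Y N norm g * onorm_on (g ` Y) norm N (inv_into Y g) < 1 + \<epsilon>"
proof -
  interpret t: vector_space t by (fact t)
  have fs: "vector_space (fscale :: 'k \<Rightarrow> _)" by unfold_locales
  from Y obtain B where B: "finite B" "Y = t.span B" and subY: "t.subspace Y"
    and N: "norm_on t Y N"
    by (auto simp: finite_dim_normed_space_def)
  obtain \<phi> where \<phi>: "linear_map_on Y t fscale \<phi>" "inj_on \<phi> Y"
    using finite_dim_coordinates[OF t B] by blast
  define \<psi> where "\<psi> = inv_into Y \<phi>"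
  have \<psi>\<phi>: "\<psi> (\<phi> x) = x" if "x \<in> Y" for x
    using that \<phi>(2) by (simp add: \<psi>_def)
  have \<psi>lin: "linear_map_on (\<phi> ` Y) fscale t \<psi>"
    unfolding \<psi>_def by (rule linear_map_on_inv_into[OF t subY \<phi>])
  have \<phi>X: "linear_map_on X t fscale \<phi>"
    using \<phi>(1) X(2) unfolding linear_map_on_def by blast
  have subY': "fscale.subspace (\<phi> ` Y)"
    by (rule linear_map_on_subspace_image[OF t fs subY \<phi>(1)])
  have subX': "fscale.subspace (\<phi> ` X)"
    by (rule linear_map_on_subspace_image[OF t fs X(1) \<phi>X])
  have span': "\<phi> ` Y = fscale.span (\<phi> ` B)"
  proof
    have BY: "B \<subseteq> Y" using B(2) t.span_superset by blast
    show "fscale.span (\<phi> ` B) \<subseteq> \<phi> ` Y"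
      using BY subY' by (intro fscale.span_minimal) auto
    have "x \<in> Y \<and> \<phi> x \<in> fscale.span (\<phi> ` B)" if "x \<in> t.span B" for x
      using that
    proof (induction rule: t.span_induct_alt)
      case base
      have "\<phi> 0 = 0"
        using \<phi>(1) t.subspace_0[OF subY] unfolding linear_map_on_def
        by (metis t.scale_zero_left fscale.scale_zero_left)
      then show ?case using t.subspace_0[OF subY] fscale.span_zero by metis
    next
      case (step c x y)
      have *: "x \<in> Y" "t c x \<in> Y" using step BY subY t.subspace_scale by blast+
      have "\<phi> (t c x + y) = fscale c (\<phi> x) + \<phi> y"
        using * step \<phi>(1) unfolding linear_map_on_def by metis
      then show ?case
        using * step t.subspace_add[OF subY]
        by (metis fscale.span_add fscale.span_scale fscale.span_base imageI)
    qed
    then show "\<phi> ` Y \<subseteq> fscale.span (\<phi> ` B)" using B(2) by blast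
  qed
  have \<psi>in: "\<psi> x \<in> Y" if "x \<in> \<phi> ` Y" for x using that \<psi>\<phi> by auto
  have \<psi>0: "\<psi> x = 0 \<longleftrightarrow> x = 0" if "x \<in> \<phi> ` Y" for x
  proof -
    have "\<phi> 0 = 0"
      using \<phi>(1) t.subspace_0[OF subY] unfolding linear_map_on_def
      by (metis t.scale_zero_left fscale.scale_zero_left)
    then show ?thesis using that \<psi>\<phi> t.subspace_0[OF subY] by (metis imageE)
  qed
  have N': "norm_on fscale (\<phi> ` Y) (N \<circ> \<psi>)"
    unfolding norm_on_def o_def
  proof (intro conjI ballI allI)
    fix x c assume x: "x \<in> \<phi> ` Y"
    show "0 \<le> N (\<psi> x)" using N \<psi>in[OF x] by (simp add: norm_on_def)
    show "N (\<psi> x) = 0 \<longleftrightarrow> x = 0" using N \<psi>in[OF x] \<psi>0[OF x] by (simp add: norm_on_def)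
    have "\<psi> (fscale c x) = t c (\<psi> x)" using \<psi>lin x unfolding linear_map_on_def by blast
    then show "N (\<psi> (fscale c x)) = norm c * N (\<psi> x)"
      using N \<psi>in[OF x] by (simp add: norm_on_def)
    fix y assume y: "y \<in> \<phi> ` Y"
    have "\<psi> (x + y) = \<psi> x + \<psi> y" using \<psi>lin x y unfolding linear_map_on_def by blast
    then show "N (\<psi> (x + y)) \<le> N (\<psi> x) + N (\<psi> y)"
      using N \<psi>in[OF x] \<psi>in[OF y] by (simp add: norm_on_def)
  qed
  have Y': "finite_dim_normed_space fscale (\<phi> ` Y) (N \<circ> \<psi>)"
    unfolding finite_dim_normed_space_def using subY' span' N' B(1) by blast
  have f': "isometry_on (\<phi> ` X) fscale (N \<circ> \<psi>) s norm (f \<circ> \<psi>)"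
  proof -
    have "linear_map_on (\<phi> ` X) fscale t \<psi>"
      using \<psi>lin X(2) unfolding linear_map_on_def by blast
    moreover have "\<psi> ` \<phi> ` X \<subseteq> X" using X(2) \<psi>\<phi> by auto
    ultimately show ?thesis
      using f unfolding isometry_on_def
      by (auto intro: linear_map_on_compose)
  qed
  have "\<exists>g. linear_map_on (\<phi> ` Y) fscale s g \<and> inj_on g (\<phi> ` Y) \<and>
      (\<forall>x\<in>\<phi> ` X. g x = (f \<circ> \<psi>) x) \<and>
      onorm_on (\<phi> ` Y) (N \<circ> \<psi>) norm g *
        onorm_on (g ` \<phi> ` Y) norm (N \<circ> \<psi>) (inv_into (\<phi> ` Y) g) < 1 + \<epsilon>"
    using G Y' subX' X(2) eps f' unfolding gurarii_def by blast
  then obtain g where g: "linear_map_on (\<phi> ` Y) fscale s g" "inj_on g (\<phi> ` Y)"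
      "\<forall>x\<in>\<phi> ` X. g x = (f \<circ> \<psi>) x"
      "onorm_on (\<phi> ` Y) (N \<circ> \<psi>) norm g *
        onorm_on (g ` \<phi> ` Y) norm (N \<circ> \<psi>) (inv_into (\<phi> ` Y) g) < 1 + \<epsilon>"
    by blast
  have inj: "inj_on (g \<circ> \<phi>) Y" using \<phi>(2) g(2) by (rule comp_inj_on)
  have "onorm_on (\<phi> ` Y) (N \<circ> \<psi>) norm g = onorm_on Y N norm (g \<circ> \<phi>)"
    unfolding onorm_on_def image_image o_def by (rule SUP_cong) (simp_all add: \<psi>\<phi>)
  moreover have "onorm_on (g ` \<phi> ` Y) norm (N \<circ> \<psi>) (inv_into (\<phi> ` Y) g) =
      onorm_on ((g \<circ> \<phi>) ` Y) norm N (inv_into Y (g \<circ> \<phi>))"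
  proof -
    have 1: "inv_into (\<phi> ` Y) g (g (\<phi> x)) = \<phi> x" if "x \<in> Y" for x
      using that g(2) by simp
    have 2: "inv_into Y (g \<circ> \<phi>) (g (\<phi> x)) = x" if "x \<in> Y" for x
      using inv_into_f_f[OF inj that] by simp
    show ?thesis
      unfolding onorm_on_def image_comp [symmetric]
      unfolding image_image by (rule SUP_cong) (simp_all add: 1 2 \<psi>\<phi>)
  qed
  ultimately have "onorm_on Y N norm (g \<circ> \<phi>) *
      onorm_on ((g \<circ> \<phi>) ` Y) norm N (inv_into Y (g \<circ> \<phi>)) < 1 + \<epsilon>"
    using g(4) by simp
  moreover have "linear_map_on Y t s (g \<circ> \<phi>)"
    by (rule linear_map_on_compose[OF \<phi>(1) g(1)]) simp
  moreover have "\<forall>x\<in>X. (g \<circ> \<phi>) x = f x" using g(3) X(2) \<psi>\<phi> by auto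
  ultimately show ?thesis using inj by blast
qed

end

theory Submission
  imports Defs
begin

text \<open>
  Uniqueness is proved by the back-and-forth argument of Kubis and Solecki, phrased with finite
  tuples of vectors instead of finite dimensional subspaces.  Two tuples \<open>x\<^sub>0, \<dots>, x\<^sub>n\<^sub>-\<^sub>1\<close>
  in one space and \<open>y\<^sub>0, \<dots>, y\<^sub>n\<^sub>-\<^sub>1\<close> in another are compared through the two seminorms they induce
  on the coefficients \<open>a\<close>, namely the norms of \<open>\<Sum>i<n. a\<^sub>i x\<^sub>i\<close> and of \<open>\<Sum>i<n. a\<^sub>i y\<^sub>i\<close>
  (\<open>almost_equal_norms\<close>).

  The geometric idea is an amalgamation (\<open>amalgam_norm\<close>): if the two seminorms differ by at most
  \<open>\<epsilon>\<close> times the sum of the moduli of the coefficients, then the product of the two spaces has a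
  norm that restricts to the given norms on both factors and places \<open>(x\<^sub>i, 0)\<close> within \<open>\<epsilon>\<close> of
  \<open>(0, y\<^sub>i)\<close> for every \<open>i\<close>.  In a Gurarii space the identity of the first factor extends
  almost isometrically to the second one, so the \<open>y\<close>-tuple, together with any finitely many
  further vectors, has a copy in the first space that is as accurate as desired and lies within
  \<open>2 \<epsilon>\<close> of the \<open>x\<close>-tuple (\<open>gurarii_copy_tuple\<close>).

  Applying this alternately to the two spaces, with errors halving at every round, lengthens the
  tuples while moving the old entries less and less.  If the entries added along the way are taken
  from dense sequences, the limits are dense sequences \<open>x\<close> and \<open>y\<close> whose linear combinations
  have equal norms (\<open>back_and_forth\<close>).  The correspondence of \<open>x\<^sub>i\<close> with \<open>y\<^sub>i\<close> then extends
  by continuity to a bijective linear isometry (\<open>isometry_of_dense_sequences\<close>).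

  The scalars enter only through compactness of closed balls, so both fields are covered at once.
\<close>

section \<open>Equivalence of norms in finite dimension\<close>

lemma norm_on_sum_le:
  assumes t: "vector_space t" and V: "module.subspace t V" and N: "norm_on t V N"
    and v: "\<And>i. i \<in> I \<Longrightarrow> v i \<in> V"
  shows "N (\<Sum>i\<in>I. t (a i) (v i)) \<le> (\<Sum>i\<in>I. norm (a i) * N (v i))"
proof -
  interpret t: vector_space t by (fact t)
  have N0: "N 0 = 0" using N t.subspace_0[OF V] by (simp add: norm_on_def)
  show ?thesis using v
  proof (induction I rule: infinite_finite_induct)
    case (insert i I)
    have "(\<Sum>i\<in>I. t (a i) (v i)) \<in> V" "t (a i) (v i) \<in> V"
      using insert.prems by (auto intro!: t.subspace_sum[OF V] t.subspace_scale[OF V])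
    then have "N (t (a i) (v i) + (\<Sum>i\<in>I. t (a i) (v i)))
        \<le> N (t (a i) (v i)) + N (\<Sum>i\<in>I. t (a i) (v i))"
      using N by (simp add: norm_on_def)
    moreover have "N (t (a i) (v i)) = norm (a i) * N (v i)"
      using N insert.prems by (simp add: norm_on_def)
    ultimately show ?case using insert by simp
  qed (simp_all add: N0)
qed

text \<open>
  The sum of the moduli of the coefficients equals \<open>1\<close> on a compact set of coefficient families,
  by compactness of closed balls in the scalar field and Tychonoff's theorem.  There the
  continuous function \<open>N\<close> attains its minimum, which is positive because \<open>B\<close> is independent;
  homogeneity does the rest.
\<close>

lemma norm_on_ge_coordinates:
  fixes t :: "'k::{real_normed_field,heine_borel} \<Rightarrow> 'u::ab_group_add \<Rightarrow> 'u"
  assumes t: "vector_space t" and fin: "finite B" and ind: "\<not> module.dependent t B"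
    and N: "norm_on t (module.span t B) N"
  shows "\<exists>c>0. \<forall>a. c * (\<Sum>b\<in>B. norm (a b)) \<le> N (\<Sum>b\<in>B. t (a b) b)"
proof (cases "B = {}")
  case True
  interpret t: vector_space t by (fact t)
  show ?thesis using True N t.span_zero by (auto simp: norm_on_def intro!: exI[of _ 1])
next
  case False
  interpret t: vector_space t by (fact t)
  define L where "L a = (\<Sum>b\<in>B. t (a b) b)" for a
  define S where "S a = (\<Sum>b\<in>B. norm (a b))" for a :: "'u \<Rightarrow> 'k"
  define K where "K = (\<Pi>\<^sub>E b\<in>UNIV. if b \<in> B then cball 0 1 else {0}) \<inter> {a :: 'u \<Rightarrow> 'k. S a = 1}"
  have LV: "L a \<in> t.span B" for a
    unfolding L_def by (intro t.span_sum t.span_scale t.span_base)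
  have diff: "L a - L a' = (\<Sum>b\<in>B. t (a b - a' b) b)" for a a'
    by (simp add: L_def t.scale_left_diff_distrib sum_subtractf)
  have tri: "\<bar>N (L a') - N (L a)\<bar> \<le> (\<Sum>b\<in>B. norm (a' b - a b) * N b)" for a a'
  proof -
    have *: "N (L a) \<le> N (L a') + (\<Sum>b\<in>B. norm (a b - a' b) * N b)" for a a'
    proof -
      have "N (L a) \<le> N (L a') + N (L a - L a')"
        using N LV[of a] LV[of a'] t.span_diff[OF LV[of a] LV[of a']]
        unfolding norm_on_def by (metis add.commute diff_add_cancel)
      also have "N (L a - L a') \<le> (\<Sum>b\<in>B. norm (a b - a' b) * N b)"
        unfolding diff by (rule norm_on_sum_le[OF t t.subspace_span N]) (rule t.span_base)
      finally show ?thesis by simp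
    qed
    show ?thesis using *[of a a'] *[of a' a] by (simp add: norm_minus_commute abs_le_iff)
  qed
  have contS: "continuous_on UNIV S"
    unfolding S_def by (intro continuous_intros continuous_on_product_then_coordinatewise[OF continuous_on_id])
  have cont: "continuous_on K (\<lambda>a. N (L a))"
  proof (rule continuous_on_subset[of UNIV])
    have "((\<lambda>a. N (L a)) \<longlongrightarrow> N (L a)) (at a)" for a
    proof -
      have "continuous_on UNIV (\<lambda>a'. \<Sum>b\<in>B. norm (a' b - a b) * N b)"
        by (intro continuous_intros continuous_on_product_then_coordinatewise[OF continuous_on_id])
      then have "((\<lambda>a'. \<Sum>b\<in>B. norm (a' b - a b) * N b) \<longlongrightarrow> 0) (at a)"
        unfolding continuous_on_def by (auto dest!: spec[of _ a])
      then have "((\<lambda>a'. N (L a') - N (L a)) \<longlongrightarrow> 0) (at a)"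
        by (rule Lim_null_comparison[rotated]) (simp add: tri)
      then show ?thesis by (simp add: LIM_zero_iff)
    qed
    then show "continuous_on UNIV (\<lambda>a. N (L a))"
      by (simp add: continuous_on_def)
  qed simp
  have compK: "compact K"
    unfolding K_def
  proof (rule compact_Int_closed)
    have "compactin (product_topology (\<lambda>i. euclidean) UNIV)
       (\<Pi>\<^sub>E b\<in>UNIV. if b \<in> B then cball 0 1 else {0 :: 'k})"
      unfolding compactin_PiE by auto
    then show "compact (\<Pi>\<^sub>E b\<in>UNIV. if b \<in> B then cball 0 1 else {0 :: 'k})"
      by (simp add: euclidean_product_topology)
    show "closed {a. S a = 1}"
      by (intro closed_Collect_eq contS continuous_intros)
  qed
  obtain b0 where b0: "b0 \<in> B" using False by auto
  have ne: "K \<noteq> {}"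
  proof -
    have "S (\<lambda>b. if b = b0 then 1 else 0) = (\<Sum>b\<in>B. if b = b0 then 1 else 0)"
      unfolding S_def by (rule sum.cong) auto
    then have "(\<lambda>b. if b = b0 then 1 else 0) \<in> K"
      using b0 fin by (auto simp: K_def)
    then show ?thesis by blast
  qed
  obtain k where k: "k \<in> K" "\<And>a. a \<in> K \<Longrightarrow> N (L k) \<le> N (L a)"
    using continuous_attains_inf[OF compK ne cont] by blast
  have pos: "N (L k) > 0"
  proof -
    have "L k \<noteq> 0"
    proof
      assume "L k = 0"
      then have "\<forall>b\<in>B. k b = 0"
        using ind fin t.dependent_finite[OF fin] unfolding L_def by blast
      then show False using k(1) by (simp add: K_def S_def)
    qed
    then show ?thesis using N LV[of k] unfolding norm_on_def by (metis order_le_less)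
  qed
  have "N (L k) * S a \<le> N (L a)" for a
  proof (cases "S a = 0")
    case True
    then show ?thesis using N LV[of a] by (simp add: norm_on_def)
  next
    case False
    have Sa: "S a > 0" using False by (simp add: S_def less_le sum_nonneg)
    define r :: 'k where "r = of_real (1 / S a)"
    define a' where "a' b = (if b \<in> B then r * a b else 0)" for b
    have nr: "norm r = 1 / S a" using Sa by (simp add: r_def norm_divide)
    have "norm (a b) \<le> S a" if "b \<in> B" for b
      unfolding S_def using that fin by (intro member_le_sum) auto
    then have "a' \<in> K" using Sa
      by (auto simp: K_def S_def a'_def norm_mult nr sum_divide_distrib[symmetric] PiE_def)
    from k(2)[OF this] have "N (L k) \<le> N (L a')" .
    also have "L a' = t r (L a)" by (simp add: L_def a'_def t.scale_sum_right)
    also have "N \<dots> = N (L a) / S a" using N LV[of a] nr by (simp add: norm_on_def)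
    finally show ?thesis using Sa by (simp add: field_simps)
  qed
  then show ?thesis using pos unfolding L_def S_def by blast
qed

text \<open>
  An operator norm \<open>onorm_on\<close>, being a supremum of reals, carries information only when the
  operator is bounded.  Here \<open>M\<close> and \<open>N\<close> will be the norm of the domain and the norm pulled
  back along an injective operator, so that applying this in both directions bounds the operator
  and its inverse.
\<close>

lemma norm_on_equivalent:
  fixes t :: "'k::{real_normed_field,heine_borel} \<Rightarrow> 'u::ab_group_add \<Rightarrow> 'u"
  assumes t: "vector_space t" and Y: "finite_dim_normed_space t Y N" and M: "norm_on t Y M"
  shows "\<exists>C. \<forall>y\<in>Y. M y \<le> C * N y"
proof -
  interpret t: vector_space t by (fact t)
  obtain B where B: "finite B" "Y = t.span B" and N: "norm_on t Y N"
    using Y by (auto simp: finite_dim_normed_space_def)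
  obtain C where C: "C \<subseteq> B" "t.independent C" "t.span C = Y"
    using t.basis_exists[of B] B(2) by (metis t.span_mono t.span_span subset_antisym)
  have finC: "finite C" using C(1) B(1) finite_subset by blast
  have CY: "b \<in> Y" if "b \<in> C" for b using that C(3) t.span_base by blast
  obtain c where c: "c > 0" "\<And>a. c * (\<Sum>b\<in>C. norm (a b)) \<le> N (\<Sum>b\<in>C. t (a b) b)"
    using norm_on_ge_coordinates[OF t finC C(2)] N C(3) by metis
  define D where "D = (\<Sum>b\<in>C. M b)"
  have M0: "M b \<ge> 0" if "b \<in> C" for b using M CY[OF that] by (simp add: norm_on_def)
  have D: "D \<ge> 0" unfolding D_def using M0 by (rule sum_nonneg)
  have "M y \<le> (D / c) * N y" if "y \<in> Y" for y
  proof -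
    define a where "a = t.representation C y"
    have y: "y = (\<Sum>b\<in>C. t (a b) b)"
      unfolding a_def using t.sum_representation_eq[OF C(2) _ finC subset_refl] C(3) that by simp
    have "M y \<le> (\<Sum>b\<in>C. norm (a b) * M b)"
      unfolding y using norm_on_sum_le[OF t _ M, of C "\<lambda>b. b"] CY C(3) t.subspace_span by metis
    also have "\<dots> \<le> (\<Sum>b\<in>C. norm (a b) * D)"
      unfolding D_def by (intro sum_mono mult_left_mono member_le_sum M0 finC) auto
    also have "\<dots> = D * (\<Sum>b\<in>C. norm (a b))"
      by (simp add: sum_distrib_left mult.commute)
    also have "\<dots> \<le> D * (N y / c)"
      using c(2)[of a] c(1) D unfolding y by (intro mult_left_mono) (auto simp: field_simps)
    finally show ?thesis by simp
  qed
  then show ?thesis by blast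
qed

section \<open>Almost isometric extensions\<close>

lemma le_onorm_on:
  assumes N: "\<And>y. y \<in> V \<Longrightarrow> 0 \<le> N y" and C: "\<And>y. y \<in> V \<Longrightarrow> M (g y) \<le> C * N y"
    and y: "y \<in> V"
  shows "M (g y) \<le> onorm_on V N M g * N y"
proof (cases "N y = 0")
  case True
  then show ?thesis using C[OF y] by simp
next
  case False
  have "M (g x) / N x \<le> max C 0" if "x \<in> V" for x
    using C[OF that] N[OF that]
    by (cases "N x = 0") (auto simp: divide_le_eq intro: order_trans mult_right_mono)
  then have "bdd_above ((\<lambda>x. M (g x) / N x) ` V)" by (rule bdd_aboveI2)
  then have "M (g y) / N y \<le> onorm_on V N M g"
    unfolding onorm_on_def using y by (rule cSUP_upper2) simp
  then show ?thesis using N[OF y] False by (simp add: divide_le_eq)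
qed

text \<open>
  The definition of a Gurarii space controls only the product of the norms of \<open>g\<close> and of its
  inverse.  A nonzero vector of \<open>X\<close>, on which \<open>g\<close> is isometric, forces both norms to be at
  least \<open>1\<close>, hence each of them is at most \<open>1 + \<epsilon>\<close>.
\<close>

lemma gurarii_almost_isometric_extension:
  fixes s :: "'k::{real_normed_field,heine_borel} \<Rightarrow> 'a::banach \<Rightarrow> 'a"
    and t :: "'k \<Rightarrow> 'u::ab_group_add \<Rightarrow> 'u"
  assumes G: "gurarii s" and t: "vector_space t" and Y: "finite_dim_normed_space t Y N"
    and X: "module.subspace t X" "X \<subseteq> Y" and x0: "x0 \<in> X" "x0 \<noteq> 0"
    and eps: "\<epsilon> > 0" and f: "isometry_on X t N s norm f"
  obtains g where "linear_map_on Y t s g" "\<And>x. x \<in> X \<Longrightarrow> g x = f x"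
    "\<And>y. y \<in> Y \<Longrightarrow> norm (g y) \<le> (1 + \<epsilon>) * N y" "\<And>y. y \<in> Y \<Longrightarrow> N y \<le> (1 + \<epsilon>) * norm (g y)"
proof -
  interpret t: vector_space t by (fact t)
  interpret s: scaled_normed_space s using G by (simp add: gurarii_def)
  obtain g where g: "linear_map_on Y t s g" "inj_on g Y" "\<And>x. x \<in> X \<Longrightarrow> g x = f x"
      and prod: "onorm_on Y N norm g * onorm_on (g ` Y) norm N (inv_into Y g) < 1 + \<epsilon>"
    using gurarii_extension[OF G t Y X eps f] by blast
  define a where "a = onorm_on Y N norm g"
  define b where "b = onorm_on (g ` Y) norm N (inv_into Y g)"
  have N: "norm_on t Y N" and subY: "t.subspace Y"
    using Y by (auto simp: finite_dim_normed_space_def)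
  have g0: "g 0 = 0"
    using g(1) t.subspace_0[OF subY] unfolding linear_map_on_def
    by (metis t.scale_zero_left s.scale_zero_left)
  have gz: "g y = 0 \<longleftrightarrow> y = 0" if "y \<in> Y" for y
    using g(2) that t.subspace_0[OF subY] g0 by (metis inj_onD)
  have M: "norm_on t Y (\<lambda>y. norm (g y))"
    unfolding norm_on_def using g(1) gz
    by (auto simp: linear_map_on_def s.norm_scale norm_triangle_ineq)
  have Y': "finite_dim_normed_space t Y (\<lambda>y. norm (g y))"
    using Y M by (simp add: finite_dim_normed_space_def)
  obtain C where C: "\<And>y. y \<in> Y \<Longrightarrow> norm (g y) \<le> C * N y"
    using norm_on_equivalent[OF t Y M] by blast
  obtain D where D: "\<And>y. y \<in> Y \<Longrightarrow> N y \<le> D * norm (g y)"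
    using norm_on_equivalent[OF t Y' N] by blast
  have N0: "0 \<le> N y" if "y \<in> Y" for y using N that by (simp add: norm_on_def)
  have up: "norm (g y) \<le> a * N y" if "y \<in> Y" for y
    unfolding a_def using N0 C that by (rule le_onorm_on)
  have low: "N y \<le> b * norm (g y)" if "y \<in> Y" for y
  proof -
    have "N (inv_into Y g (g y)) \<le> b * norm (g y)"
      unfolding b_def
      by (rule le_onorm_on[where C = D]) (use D g(2) that in auto)
    then show ?thesis using g(2) that by simp
  qed
  have x0Y: "x0 \<in> Y" using x0 X by blast
  have "norm (g x0) = N x0" "N x0 > 0"
    using x0 x0Y g(3) f N by (auto simp: isometry_on_def norm_on_def less_le)
  then have ab: "a \<ge> 1" "b \<ge> 1" using up[OF x0Y] low[OF x0Y] by auto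
  then have "a * 1 \<le> a * b" "1 * b \<le> a * b"
    by (auto intro!: mult_left_mono mult_right_mono)
  then have "a \<le> 1 + \<epsilon>" "b \<le> 1 + \<epsilon>"
    using prod by (auto simp: a_def b_def)
  then have "norm (g y) \<le> (1 + \<epsilon>) * N y" "N y \<le> (1 + \<epsilon>) * norm (g y)" if "y \<in> Y" for y
    using up[OF that] low[OF that] N0[OF that]
    by (meson order_trans mult_right_mono norm_ge_zero)+
  then show thesis using that g by blast
qed

text \<open>
  Supplies the nonzero vector on which an almost isometric extension is normalised: the scalar
  line extends the zero space, so it embeds into every Gurarii space.
\<close>

lemma gurarii_nontrivial:
  fixes s :: "'k::real_normed_field \<Rightarrow> 'a::banach \<Rightarrow> 'a"
  assumes G: "gurarii s"
  obtains e where "e \<noteq> (0 :: 'a)"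
proof -
  interpret s: scaled_normed_space s using G by (simp add: gurarii_def)
  have "x \<in> vector_space_over_itself.span {1}" for x
    using vector_space_over_itself.span_scale[OF vector_space_over_itself.span_base[of 1 "{1}"], of x] by simp
  then have span: "UNIV = vector_space_over_itself.span {1}" by blast
  have Y: "finite_dim_normed_space ((*) :: 'k \<Rightarrow> 'k \<Rightarrow> 'k) UNIV norm"
    unfolding finite_dim_normed_space_def norm_on_def
    using span by (auto simp: norm_mult norm_triangle_ineq intro!: exI[of _ "{1}"])
  have "isometry_on {0} ((*) :: 'k \<Rightarrow> 'k \<Rightarrow> 'k) norm s norm (\<lambda>_. 0)"
    by (simp add: isometry_on_def linear_map_on_def)
  then obtain g :: "'k \<Rightarrow> 'a" where "inj_on g UNIV"
    using gurarii_extension[OF G vector_space_over_itself.vector_space_axioms Y vector_space_over_itself.subspace_single_0, of 1] by auto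
  then have "g 0 \<noteq> g 1" by (simp add: inj_eq)
  then show thesis using that by (metis)
qed

section \<open>Amalgamation of almost isometric tuples\<close>

text \<open>
  For \<open>\<epsilon> = 0\<close> this says that \<open>x\<^sub>i \<mapsto> y\<^sub>i\<close> defines an isometry between the spans.  The error
  is measured by the coefficients and not by the norm of the linear combination; thus the tuples
  may be linearly dependent, and moving every entry of one of them by at most \<open>\<eta>\<close> increases the
  error by at most \<open>\<eta>\<close>.
\<close>

definition almost_equal_norms ::
  "('k::real_normed_field \<Rightarrow> 'e::real_normed_vector \<Rightarrow> 'e) \<Rightarrow> ('k \<Rightarrow> 'f::real_normed_vector \<Rightarrow> 'f) \<Rightarrow>
     nat \<Rightarrow> real \<Rightarrow> (nat \<Rightarrow> 'e) \<Rightarrow> (nat \<Rightarrow> 'f) \<Rightarrow> bool" where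
  "almost_equal_norms s t n \<epsilon> x y \<longleftrightarrow>
     (\<forall>a. \<bar>norm (\<Sum>i<n. s (a i) (x i)) - norm (\<Sum>i<n. t (a i) (y i))\<bar> \<le> \<epsilon> * (\<Sum>i<n. norm (a i)))"

lemma almost_equal_norms_sym:
  "almost_equal_norms s t n \<epsilon> x y \<Longrightarrow> almost_equal_norms t s n \<epsilon> y x"
  by (simp add: almost_equal_norms_def abs_minus_commute)

lemma (in scaled_normed_space) norm_sum_scale_le:
  "norm (\<Sum>i\<in>I. scale (a i) (x i)) \<le> (\<Sum>i\<in>I. norm (a i) * norm (x i))"
  by (rule order_trans[OF norm_sum]) (simp add: norm_scale)

lemma (in scaled_normed_space) norm_sum_scale_le_bound:
  assumes "\<And>i. i \<in> I \<Longrightarrow> norm (x i) \<le> c"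
  shows "norm (\<Sum>i\<in>I. scale (a i) (x i)) \<le> c * (\<Sum>i\<in>I. norm (a i))"
proof -
  have "(\<Sum>i\<in>I. norm (a i) * norm (x i)) \<le> (\<Sum>i\<in>I. norm (a i) * c)"
    using assms by (intro sum_mono mult_left_mono) auto
  then show ?thesis using norm_sum_scale_le[of a x I]
    by (simp add: sum_distrib_left mult.commute)
qed

text \<open>
  The norm is the infimum over all coefficients \<open>w\<close> of
  \<open>norm (u + \<Sum>i<n. w\<^sub>i x\<^sub>i) + norm (v - \<Sum>i<n. w\<^sub>i y\<^sub>i) + \<epsilon> (\<Sum>i<n. norm w\<^sub>i)\<close>:
  a part of \<open>u\<close> may be traded for the corresponding part of \<open>v\<close> at the price \<open>\<epsilon>\<close> per unit of
  coefficient.  Trading one unit of \<open>x\<^sub>i\<close> bounds the norm of \<open>(- x\<^sub>i, y\<^sub>i)\<close>.  Trading never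
  makes \<open>(u, 0)\<close> or \<open>(0, v)\<close> cheaper, since the price covers the possible difference of the
  norms of \<open>\<Sum>i<n. w\<^sub>i x\<^sub>i\<close> and \<open>\<Sum>i<n. w\<^sub>i y\<^sub>i\<close>.
\<close>

lemma amalgam_norm:
  fixes s :: "'k::real_normed_field \<Rightarrow> 'e::real_normed_vector \<Rightarrow> 'e"
    and t :: "'k \<Rightarrow> 'f::real_normed_vector \<Rightarrow> 'f"
  assumes s: "scaled_normed_space s" and t: "scaled_normed_space t"
    and close: "almost_equal_norms s t n \<epsilon> x y" and eps: "\<epsilon> > 0"
  obtains N where "norm_on (module_prod.scale s t) UNIV N"
    "\<And>u. N (u, 0) = norm u" "\<And>v. N (0, v) = norm v" "\<And>i. i < n \<Longrightarrow> N (- x i, y i) \<le> \<epsilon>"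
proof -
  interpret s: scaled_normed_space s by (fact s)
  interpret t: scaled_normed_space t by (fact t)
  interpret vector_space_prod s t by unfold_locales
  define X where "X w = (\<Sum>i<n. s (w i) (x i))" for w
  define Y where "Y w = (\<Sum>i<n. t (w i) (y i))" for w
  define S where "S w = (\<Sum>i<n. norm (w i))" for w :: "nat \<Rightarrow> 'k"
  define F where "F p w = norm (fst p + X w) + norm (snd p - Y w) + \<epsilon> * S w" for p w
  define N where "N p = (INF w. F p w)" for p
  have S0: "0 \<le> S w" for w by (simp add: S_def sum_nonneg)
  have F0: "0 \<le> F p w" for p w using S0 eps by (simp add: F_def)
  have N_le: "N p \<le> F p w" for p w
    unfolding N_def using F0 by (intro cINF_lower bdd_belowI2[where m = 0]) auto
  have N_ge: "c \<le> N p" if "\<And>w. c \<le> F p w" for c p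
    unfolding N_def using that by (intro cINF_greatest) auto
  have X_add: "X (\<lambda>i. w i + w' i) = X w + X w'" for w w'
    by (simp add: X_def s.scale_left_distrib sum.distrib)
  have Y_add: "Y (\<lambda>i. w i + w' i) = Y w + Y w'" for w w'
    by (simp add: Y_def t.scale_left_distrib sum.distrib)
  have S_add: "S (\<lambda>i. w i + w' i) \<le> S w + S w'" for w w'
    by (auto simp: S_def sum.distrib[symmetric] intro: sum_mono norm_triangle_ineq)
  have X_scale: "X (\<lambda>i. c * w i) = s c (X w)" for c w
    by (simp add: X_def s.scale_sum_right)
  have Y_scale: "Y (\<lambda>i. c * w i) = t c (Y w)" for c w
    by (simp add: Y_def t.scale_sum_right)
  have S_scale: "S (\<lambda>i. c * w i) = norm c * S w" for c w
    by (simp add: S_def norm_mult sum_distrib_left)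
  have XY: "\<bar>norm (X w) - norm (Y w)\<bar> \<le> \<epsilon> * S w" for w
    using close by (simp add: almost_equal_norms_def X_def Y_def S_def)
  have F_scale: "F (scale c p) (\<lambda>i. c * w i) = norm c * F p w" for c p w
  proof -
    have "fst (scale c p) + X (\<lambda>i. c * w i) = s c (fst p + X w)"
      by (simp add: scale_def X_scale s.scale_right_distrib)
    moreover have "snd (scale c p) - Y (\<lambda>i. c * w i) = t c (snd p - Y w)"
      by (simp add: scale_def Y_scale t.scale_right_diff_distrib)
    ultimately show ?thesis
      unfolding F_def by (simp only: s.norm_scale t.norm_scale S_scale) (simp add: distrib_left)
  qed
  have F_add: "F (p + q) (\<lambda>i. w i + w' i) \<le> F p w + F q w'" for p q w w'
  proof -
    have "norm (fst (p + q) + X (\<lambda>i. w i + w' i)) \<le> norm (fst p + X w) + norm (fst q + X w')"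
      using norm_triangle_ineq[of "fst p + X w" "fst q + X w'"] by (simp add: X_add algebra_simps)
    moreover have "norm (snd (p + q) - Y (\<lambda>i. w i + w' i)) \<le> norm (snd p - Y w) + norm (snd q - Y w')"
      using norm_triangle_ineq[of "snd p - Y w" "snd q - Y w'"] by (simp add: Y_add algebra_simps)
    moreover have "\<epsilon> * S (\<lambda>i. w i + w' i) \<le> \<epsilon> * S w + \<epsilon> * S w'"
      using mult_left_mono[OF S_add[of w w'], of \<epsilon>] eps by (simp add: distrib_left)
    ultimately show ?thesis by (simp add: F_def)
  qed
  have N0: "0 \<le> N p" for p using F0 by (rule N_ge)
  have N_fst: "N (u, 0) = norm u" for u
  proof (rule antisym)
    show "N (u, 0) \<le> norm u"
      using N_le[of "(u, 0)" "\<lambda>_. 0"] by (simp add: F_def X_def Y_def S_def)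
    show "norm u \<le> N (u, 0)"
    proof (rule N_ge)
      fix w
      have "norm u \<le> norm (u + X w) + norm (X w)"
        using norm_triangle_ineq4[of "u + X w" "X w"] by simp
      then show "norm u \<le> F (u, 0) w" using XY[of w] by (simp add: F_def)
    qed
  qed
  have N_snd: "N (0, v) = norm v" for v
  proof (rule antisym)
    show "N (0, v) \<le> norm v"
      using N_le[of "(0, v)" "\<lambda>_. 0"] by (simp add: F_def X_def Y_def S_def)
    show "norm v \<le> N (0, v)"
    proof (rule N_ge)
      fix w
      have "norm v \<le> norm (v - Y w) + norm (Y w)"
        using norm_triangle_ineq[of "v - Y w" "Y w"] by simp
      then show "norm v \<le> F (0, v) w" using XY[of w] by (simp add: F_def)
    qed
  qed
  have N_scale_le: "N (scale c p) \<le> norm c * N p" for c p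
  proof (cases "c = 0")
    case True
    then have "scale c p = (0, 0)" by (simp add: scale_def)
    then show ?thesis using N_fst[of 0] True by simp
  next
    case False
    have "N (scale c p) / norm c \<le> N p"
    proof (rule N_ge)
      fix w
      show "N (scale c p) / norm c \<le> F p w"
        using N_le[of "scale c p" "\<lambda>i. c * w i"] False unfolding F_scale
        by (simp add: divide_le_eq mult.commute)
    qed
    then show ?thesis using False by (simp add: divide_le_eq mult.commute)
  qed
  have N_scale: "N (scale c p) = norm c * N p" for c p
  proof (cases "c = 0")
    case True
    then show ?thesis using N_scale_le[of c p] N0[of "scale c p"] by simp
  next
    case False
    have "N (scale (inverse c) (scale c p)) \<le> norm (inverse c) * N (scale c p)"
      by (rule N_scale_le)
    moreover have "scale (inverse c) (scale c p) = p" using False by simp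
    ultimately have "norm c * N p \<le> N (scale c p)"
      using False by (simp add: norm_divide field_simps)
    then show ?thesis using N_scale_le[of c p] by simp
  qed
  have N_add: "N (p + q) \<le> N p + N q" for p q
  proof -
    have "N (p + q) - F p w \<le> N q" for w
    proof (rule N_ge)
      fix w'
      show "N (p + q) - F p w \<le> F q w'"
        using N_le[of "p + q" "\<lambda>i. w i + w' i"] F_add[of p q w w'] by simp
    qed
    then have "N (p + q) - N q \<le> F p w" for w by (simp add: algebra_simps)
    then have "N (p + q) - N q \<le> N p" by (rule N_ge)
    then show ?thesis by simp
  qed
  have N_eq0: "p = 0" if "N p = 0" for p
  proof -
    define C where "C = (\<Sum>i<n. norm (x i)) + (\<Sum>i<n. norm (y i))"
    have C0: "C \<ge> 0" by (simp add: C_def sum_nonneg)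
    have le: "norm (x i) \<le> C" "norm (y i) \<le> C" if "i < n" for i
    proof -
      have "norm (x i) \<le> (\<Sum>i<n. norm (x i))" "norm (y i) \<le> (\<Sum>i<n. norm (y i))"
        using that by (auto intro: member_le_sum)
      moreover have "0 \<le> (\<Sum>i<n. norm (x i))" "0 \<le> (\<Sum>i<n. norm (y i))"
        by (simp_all add: sum_nonneg)
      ultimately show "norm (x i) \<le> C" "norm (y i) \<le> C" unfolding C_def by linarith+
    qed
    have XC: "norm (X w) \<le> C * S w" and YC: "norm (Y w) \<le> C * S w" for w
      unfolding X_def Y_def S_def using le
      by (auto intro!: s.norm_sum_scale_le_bound t.norm_sum_scale_le_bound)
    \<comment> \<open>The price of \<open>w\<close> bounds both traded vectors up to the factor \<open>C / \<epsilon>\<close>, so a pair of small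
       norm has small components.\<close>
    define r where "r = max 1 (C / \<epsilon>)"
    have r: "r \<ge> 1" "C \<le> r * \<epsilon>" using eps by (auto simp: r_def divide_le_eq max_def)
    have F_lower: "d \<le> r * F p w"
      if "d \<le> norm (fst p + X w) + norm (snd p - Y w) + C * S w" for d w
    proof -
      have "C * S w \<le> r * (\<epsilon> * S w)" using mult_right_mono[OF r(2) S0[of w]] by simp
      moreover have "norm (fst p + X w) \<le> r * norm (fst p + X w)"
        "norm (snd p - Y w) \<le> r * norm (snd p - Y w)"
        using mult_right_mono[OF r(1) norm_ge_zero] by simp_all
      ultimately show ?thesis using that by (simp add: F_def distrib_left)
    qed
    have "norm (fst p) \<le> r * F p w" "norm (snd p) \<le> r * F p w" for w
    proof -
      have "norm (fst p) \<le> norm (fst p + X w) + norm (X w)"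
        using norm_triangle_ineq4[of "fst p + X w" "X w"] by simp
      then show "norm (fst p) \<le> r * F p w"
        using XC[of w] norm_ge_zero[of "snd p - Y w"] by (intro F_lower) linarith
      have "norm (snd p) \<le> norm (snd p - Y w) + norm (Y w)"
        using norm_triangle_ineq[of "snd p - Y w" "Y w"] by simp
      then show "norm (snd p) \<le> r * F p w"
        using YC[of w] norm_ge_zero[of "fst p + X w"] by (intro F_lower) linarith
    qed
    then have "norm (fst p) / r \<le> F p w" "norm (snd p) / r \<le> F p w" for w
      using r(1) by (simp_all add: divide_le_eq mult.commute)
    then have "norm (fst p) / r \<le> N p" "norm (snd p) / r \<le> N p" by (auto intro: N_ge)
    then show "p = 0" using that r(1) by (simp add: divide_le_eq prod_eq_iff)
  qed
  have "N (- x i, y i) \<le> \<epsilon>" if "i < n" for i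
  proof -
    \<comment> \<open>Trade exactly one unit of \<open>x i\<close> against \<open>y i\<close>.\<close>
    define w where "w = (\<lambda>j. if j = i then 1 else 0 :: 'k)"
    have "X w = (\<Sum>j<n. if j = i then x j else 0)" "Y w = (\<Sum>j<n. if j = i then y j else 0)"
      "S w = (\<Sum>j<n. if j = i then 1 else 0)"
      unfolding X_def Y_def S_def w_def by (rule sum.cong; simp)+
    then have "X w = x i" "Y w = y i" "S w = 1" using that by auto
    then show ?thesis using N_le[of "(- x i, y i)" w] by (simp add: F_def)
  qed
  moreover have "norm_on scale UNIV N"
    unfolding norm_on_def
  proof (intro conjI ballI allI)
    show "N p = 0 \<longleftrightarrow> p = 0" for p
      using N_eq0[of p] N_fst[of 0] by (auto simp: zero_prod_def)
  qed (rule N0 N_scale N_add)+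
  ultimately show thesis using that[of N] N_fst N_snd by simp
qed

section \<open>Copying tuples between Gurarii spaces\<close>

lemma linear_map_on_sum:
  assumes s: "vector_space s" and t: "vector_space t" and V: "module.subspace s V"
    and f: "linear_map_on V s t f" and v: "\<And>i. i \<in> I \<Longrightarrow> v i \<in> V"
  shows "f (\<Sum>i\<in>I. s (a i) (v i)) = (\<Sum>i\<in>I. t (a i) (f (v i)))"
proof -
  interpret s: vector_space s by (fact s)
  interpret t: vector_space t by (fact t)
  have f0: "f 0 = 0"
    using f s.subspace_0[OF V] unfolding linear_map_on_def
    by (metis s.scale_zero_left t.scale_zero_left)
  show ?thesis using v
  proof (induction I rule: infinite_finite_induct)
    case (insert i I)
    have "(\<Sum>i\<in>I. s (a i) (v i)) \<in> V" "s (a i) (v i) \<in> V"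
      using insert.prems by (auto intro!: s.subspace_sum[OF V] s.subspace_scale[OF V])
    then have "f (s (a i) (v i) + (\<Sum>i\<in>I. s (a i) (v i)))
        = f (s (a i) (v i)) + f (\<Sum>i\<in>I. s (a i) (v i))"
      using f by (simp add: linear_map_on_def)
    then show ?case using insert f by (simp add: linear_map_on_def)
  qed (simp_all add: f0)
qed

lemma almost_equal_norms_cong:
  assumes "\<And>i. i < n \<Longrightarrow> x i = x' i" "\<And>i. i < n \<Longrightarrow> y i = y' i"
  shows "almost_equal_norms s t n \<epsilon> x y \<longleftrightarrow> almost_equal_norms s t n \<epsilon> x' y'"
proof -
  have "(\<Sum>i<n. s (a i) (x i)) = (\<Sum>i<n. s (a i) (x' i))"
    "(\<Sum>i<n. t (a i) (y i)) = (\<Sum>i<n. t (a i) (y' i))" for a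
    using assms by (auto intro: sum.cong)
  then show ?thesis by (simp add: almost_equal_norms_def)
qed

lemma almost_equal_norms_mono:
  fixes s :: "'k::real_normed_field \<Rightarrow> 'e::real_normed_vector \<Rightarrow> 'e"
    and t :: "'k \<Rightarrow> 'f::real_normed_vector \<Rightarrow> 'f"
  assumes s: "scaled_normed_space s" and t: "scaled_normed_space t"
    and m: "almost_equal_norms s t m \<epsilon> x y" and nm: "n \<le> m"
  shows "almost_equal_norms s t n \<epsilon> x y"
  unfolding almost_equal_norms_def
proof
  interpret s: scaled_normed_space s by (fact s)
  interpret t: scaled_normed_space t by (fact t)
  fix a :: "nat \<Rightarrow> 'k"
  define a' where "a' i = (if i < n then a i else 0)" for i
  have "(\<Sum>i<m. s (a' i) (x i)) = (\<Sum>i<n. s (a i) (x i))"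
    "(\<Sum>i<m. t (a' i) (y i)) = (\<Sum>i<n. t (a i) (y i))"
    "(\<Sum>i<m. norm (a' i)) = (\<Sum>i<n. norm (a i))"
    using nm by (auto simp: a'_def intro!: sum.mono_neutral_cong_right split: if_splits)
  then show "\<bar>norm (\<Sum>i<n. s (a i) (x i)) - norm (\<Sum>i<n. t (a i) (y i))\<bar>
      \<le> \<epsilon> * (\<Sum>i<n. norm (a i))"
    using m unfolding almost_equal_norms_def by metis
qed

text \<open>
  The test space consists of the combinations of the \<open>(x\<^sub>i, 0)\<close> and the \<open>(0, y\<^sub>i)\<close> under the
  amalgamated norm.  An almost isometric extension \<open>g\<close> of the first projection sends
  \<open>(0, y\<^sub>i)\<close> to the required \<open>x'\<^sub>i\<close>: its distance to \<open>x\<^sub>i\<close> is the norm of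
  \<open>g (- x\<^sub>i, y\<^sub>i)\<close>, whose argument has amalgamated norm at most \<open>\<epsilon>\<close>.
\<close>

lemma gurarii_copy_tuple:
  fixes s :: "'k::{real_normed_field,heine_borel} \<Rightarrow> 'e::banach \<Rightarrow> 'e"
    and t :: "'k \<Rightarrow> 'f::real_normed_vector \<Rightarrow> 'f"
  assumes G: "gurarii s" and t: "scaled_normed_space t"
    and close: "almost_equal_norms s t n \<epsilon> x y" and eps: "\<epsilon> > 0"
    and delta: "\<delta> > 0" and nm: "n \<le> m"
  obtains x' where "almost_equal_norms s t m \<delta> x' y" "\<And>i. i < n \<Longrightarrow> norm (x' i - x i) \<le> 2 * \<epsilon>"
proof -
  interpret s: scaled_normed_space s using G by (simp add: gurarii_def)
  interpret t: scaled_normed_space t by (fact t)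
  interpret vector_space_prod s t by unfold_locales
  obtain N where N: "norm_on scale UNIV N"
    "\<And>u. N (u, 0) = norm u" "\<And>v. N (0, v) = norm v" "\<And>i. i < n \<Longrightarrow> N (- x i, y i) \<le> \<epsilon>"
    by (rule amalgam_norm[OF s.scaled_normed_space_axioms t close eps]) blast
  obtain e0 :: 'e where e0: "e0 \<noteq> 0" using gurarii_nontrivial[OF G] .
  \<comment> \<open>The vector \<open>e0\<close> keeps \<open>X\<close> nonzero even if all \<open>x i\<close> vanish or \<open>n = 0\<close>.\<close>
  define A where "A = insert (e0, 0) ((\<lambda>i. (x i, 0 :: 'f)) ` {..<n})"
  define B where "B = A \<union> (\<lambda>i. (0, y i)) ` {..<m}"
  define X where "X = p.span A"
  define Y where "Y = p.span B"
  have XY: "X \<subseteq> Y" unfolding X_def Y_def B_def by (intro p.span_mono) auto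
  have subX: "p.subspace X" and subY: "p.subspace Y"
    unfolding X_def Y_def by (rule p.subspace_span)+
  have xX: "(x i, 0) \<in> X" if "i < n" for i
    unfolding X_def A_def using that by (intro p.span_base) auto
  have yY: "(0, y i) \<in> Y" if "i < m" for i
    unfolding Y_def B_def using that by (intro p.span_base) auto
  have X0: "X \<subseteq> UNIV \<times> {0}"
    unfolding X_def A_def by (intro p.span_minimal subspace_Times) auto
  have finY: "finite_dim_normed_space scale Y N"
    unfolding finite_dim_normed_space_def
  proof (intro conjI exI)
    show "finite B" by (simp add: B_def A_def)
    show "norm_on scale Y N" using N(1) by (auto simp: norm_on_def)
  qed (simp_all add: Y_def)
  have iso: "isometry_on X scale N s norm fst"
    using X0 by (auto simp: isometry_on_def linear_map_on_def scale_def N(2))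
  have e0X: "(e0, 0) \<in> X" unfolding X_def A_def by (intro p.span_base) auto
  define C where "C = (\<Sum>i<m. norm (y i))"
  have C0: "C \<ge> 0" by (simp add: C_def sum_nonneg)
  \<comment> \<open>Distortion \<open>\<kappa> \<le> 1\<close> of \<open>g\<close> changes the norm of a combination of the \<open>y i\<close> by at most
     \<open>2 * \<kappa> * C\<close> per unit of coefficient.\<close>
  define \<kappa> where "\<kappa> = min 1 (\<delta> / (2 * (1 + C)))"
  have \<kappa>: "\<kappa> > 0" "\<kappa> \<le> 1" using delta C0 by (auto simp: \<kappa>_def)
  have "\<kappa> \<le> \<delta> / (2 * (1 + C))" by (simp add: \<kappa>_def)
  then have "2 * \<kappa> * (1 + C) \<le> \<delta>" using C0 by (simp add: field_simps)
  then have \<kappa>C: "2 * \<kappa> * C \<le> \<delta>" using \<kappa> by (simp add: algebra_simps)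
  obtain g where g: "linear_map_on Y scale s g" "\<And>p. p \<in> X \<Longrightarrow> g p = fst p"
    "\<And>p. p \<in> Y \<Longrightarrow> norm (g p) \<le> (1 + \<kappa>) * N p" "\<And>p. p \<in> Y \<Longrightarrow> N p \<le> (1 + \<kappa>) * norm (g p)"
    using gurarii_almost_isometric_extension
      [OF G p.vector_space_axioms finY subX XY e0X _ \<kappa>(1) iso] e0 by (auto simp: zero_prod_def)
  define x' where "x' i = g (0, y i)" for i
  have "norm (x' i - x i) \<le> 2 * \<epsilon>" if i: "i < n" for i
  proof -
    have mem: "(0, y i) \<in> Y" "(x i, 0) \<in> Y" using xX[OF i] yY[of i] XY i nm by auto
    then have mem': "scale (- 1) (x i, 0) \<in> Y" using p.subspace_scale[OF subY] by blast
    have eq: "(- x i, y i) = (0, y i) + scale (- 1) (x i, 0)" by (simp add: scale_def)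
    have "g ((0, y i) + scale (- 1) (x i, 0)) = g (0, y i) + g (scale (- 1) (x i, 0))"
      "g (scale (- 1) (x i, 0)) = s (- 1) (g (x i, 0))"
      using g(1) mem mem' unfolding linear_map_on_def by blast+
    then have "g (- x i, y i) = x' i + s (- 1) (g (x i, 0))" by (simp only: eq x'_def)
    then have "x' i - x i = g (- x i, y i)" using g(2)[OF xX[OF i]] by simp
    also have "norm \<dots> \<le> (1 + \<kappa>) * N (- x i, y i)"
      using p.subspace_add[OF subY mem(1) mem'] by (intro g(3)) (simp only: eq)
    also have "\<dots> \<le> 2 * \<epsilon>" using N(4)[OF i] \<kappa> eps N(1)
      by (intro mult_mono) (auto simp: norm_on_def)
    finally show ?thesis .
  qed
  moreover have "almost_equal_norms s t m \<delta> x' y"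
    unfolding almost_equal_norms_def
  proof
    fix a :: "nat \<Rightarrow> 'k"
    define v where "v = (\<Sum>i<m. t (a i) (y i))"
    have v: "(0, v) = (\<Sum>i<m. scale (a i) (0, y i))"
      by (simp add: prod_eq_iff fst_sum snd_sum scale_def v_def)
    have vY: "(0, v) \<in> Y"
      unfolding v using yY by (intro p.subspace_sum[OF subY] p.subspace_scale[OF subY]) auto
    have gv: "g (0, v) = (\<Sum>i<m. s (a i) (x' i))"
      unfolding v x'_def using yY
      by (intro linear_map_on_sum[OF p.vector_space_axioms s.vector_space_axioms subY g(1)]) auto
    have up: "norm (g (0, v)) \<le> (1 + \<kappa>) * norm v" and low: "norm v \<le> (1 + \<kappa>) * norm (g (0, v))"
      using g(3,4)[OF vY] by (simp_all add: N(3))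
    have "\<kappa> * norm (g (0, v)) \<le> \<kappa> * (2 * norm v)"
      using up \<kappa> mult_right_mono[of "1 + \<kappa>" 2 "norm v"] by (intro mult_left_mono) auto
    moreover have "\<kappa> * norm v \<ge> 0" using \<kappa> by simp
    ultimately have "\<bar>norm (g (0, v)) - norm v\<bar> \<le> 2 * \<kappa> * norm v"
      using up low unfolding abs_le_iff by (simp add: distrib_right)
    also have "\<dots> \<le> 2 * \<kappa> * (C * (\<Sum>i<m. norm (a i)))"
      unfolding v_def C_def using \<kappa>
      by (intro mult_left_mono t.norm_sum_scale_le_bound member_le_sum) auto
    also have "\<dots> \<le> \<delta> * (\<Sum>i<m. norm (a i))"
      using mult_right_mono[OF \<kappa>C, of "\<Sum>i<m. norm (a i)"] by (simp add: sum_nonneg mult.assoc)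
    finally show "\<bar>norm (\<Sum>i<m. s (a i) (x' i)) - norm (\<Sum>i<m. t (a i) (y i))\<bar>
        \<le> \<delta> * (\<Sum>i<m. norm (a i))"
      by (simp only: gv[symmetric] v_def[symmetric])
  qed
  ultimately show thesis using that by blast
qed

text \<open>
  One round: \<open>u\<close> becomes the entry \<open>n\<close> of the first tuple and the second tuple is adapted to
  it; then \<open>v\<close> becomes the entry \<open>n + 1\<close> of the second tuple and the first tuple is adapted.
  The second adaptation displaces \<open>u\<close> slightly, whereas \<open>v\<close> stays where it is.
\<close>

lemma back_and_forth_step:
  fixes s :: "'k::{real_normed_field,heine_borel} \<Rightarrow> 'e::banach \<Rightarrow> 'e"
    and t :: "'k \<Rightarrow> 'f::banach \<Rightarrow> 'f"
  assumes s: "gurarii s" and t: "gurarii t"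
    and close: "almost_equal_norms s t n \<epsilon> x y" and delta: "0 < \<delta>" "\<delta> \<le> \<epsilon>"
  obtains x' y' where "almost_equal_norms s t (n + 2) \<delta> x' y'"
    "\<And>i. i < n \<Longrightarrow> norm (x' i - x i) \<le> 2 * \<epsilon>" "\<And>i. i < n \<Longrightarrow> norm (y' i - y i) \<le> 2 * \<epsilon>"
    "norm (x' n - u) \<le> 2 * \<epsilon>" "y' (Suc n) = v"
proof -
  have sn: "scaled_normed_space s" and tn: "scaled_normed_space t"
    using s t by (auto simp: gurarii_def)
  define x1 where "x1 = x(n := u)"
  have "almost_equal_norms s t n \<epsilon> x1 y"
    using close by (subst almost_equal_norms_cong[of n x1 x y y]) (simp_all add: x1_def)
  then have "almost_equal_norms t s n \<epsilon> y x1" by (rule almost_equal_norms_sym)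
  then obtain y1 where y1: "almost_equal_norms t s (Suc n) \<delta> y1 x1"
      "\<And>i. i < n \<Longrightarrow> norm (y1 i - y i) \<le> 2 * \<epsilon>"
    using gurarii_copy_tuple[OF t sn _ _ delta(1), of n \<epsilon> y x1 "Suc n"] delta by auto
  define y2 where "y2 = y1(Suc n := v)"
  have "almost_equal_norms s t (Suc n) \<delta> x1 y2"
    using almost_equal_norms_sym[OF y1(1)]
    by (subst almost_equal_norms_cong[of "Suc n" x1 x1 y2 y1]) (simp_all add: y2_def)
  then obtain x2 where x2: "almost_equal_norms s t (n + 2) \<delta> x2 y2"
      "\<And>i. i < Suc n \<Longrightarrow> norm (x2 i - x1 i) \<le> 2 * \<delta>"
    using gurarii_copy_tuple[OF s tn _ delta(1) delta(1), of "Suc n" x1 y2 "n + 2"] by auto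
  show thesis
  proof (rule that[OF x2(1)])
    show "norm (x2 i - x i) \<le> 2 * \<epsilon>" if "i < n" for i
      using x2(2)[of i] that delta by (simp add: x1_def)
    show "norm (x2 n - u) \<le> 2 * \<epsilon>" using x2(2)[of n] delta by (simp add: x1_def)
  qed (use y1(2) in \<open>auto simp: y2_def\<close>)
qed

section \<open>Limits and dense sequences\<close>

lemma geometric_steps_limit:
  fixes X :: "nat \<Rightarrow> 'a::banach"
  assumes step: "\<And>k. k \<ge> m \<Longrightarrow> norm (X (Suc k) - X k) \<le> 2 * (1/2) ^ k"
  obtains L where "\<And>k. k \<ge> m \<Longrightarrow> norm (X k - L) \<le> 4 * (1/2) ^ k"
proof -
  have bound: "norm (X (k + j) - X k) \<le> 4 * (1/2) ^ k * (1 - (1/2) ^ j)" if "k \<ge> m" for k j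
  proof (induction j)
    case (Suc j)
    have "norm (X (k + Suc j) - X k)
        \<le> norm (X (Suc (k + j)) - X (k + j)) + norm (X (k + j) - X k)"
      using norm_triangle_ineq[of "X (Suc (k + j)) - X (k + j)" "X (k + j) - X k"] by simp
    also have "\<dots> \<le> 2 * (1/2) ^ (k + j) + 4 * (1/2) ^ k * (1 - (1/2) ^ j)"
      using Suc step[of "k + j"] that by simp
    also have "\<dots> = 4 * (1/2) ^ k * (1 - (1/2) ^ Suc j)"
      by (simp add: power_add algebra_simps)
    finally show ?case .
  qed simp
  have bound': "norm (X l - X k) \<le> 4 * (1/2) ^ k" if "k \<ge> m" "l \<ge> k" for k l
  proof -
    have "4 * (1/2) ^ k * (1 - (1/2) ^ (l - k)) \<le> 4 * (1/2) ^ k * (1 :: real)"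
      by (intro mult_left_mono) auto
    moreover have "norm (X l - X k) \<le> 4 * (1/2) ^ k * (1 - (1/2) ^ (l - k))"
      using bound[OF that(1), of "l - k"] that(2) by simp
    ultimately show ?thesis by linarith
  qed
  have "Cauchy X"
  proof (rule metric_CauchyI)
    fix e :: real assume "e > 0"
    then obtain K where K: "(1/2) ^ K < e / 8"
      using real_arch_pow_inv[of "e / 8" "1/2"] by auto
    have "(1/2) ^ max m K \<le> (1/2 :: real) ^ K" by (rule power_decreasing) auto
    then have K': "8 * (1/2) ^ max m K < e" using K by linarith
    have "dist (X i) (X j) < e" if "i \<ge> max m K" "j \<ge> max m K" for i j
      using bound'[of "max m K" i] bound'[of "max m K" j] that K'
        dist_triangle2[of "X i" "X j" "X (max m K)"] by (simp add: dist_norm)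
    then show "\<exists>M. \<forall>i\<ge>M. \<forall>j\<ge>M. dist (X i) (X j) < e" by blast
  qed
  then obtain L where L: "X \<longlonglongrightarrow> L" using Cauchy_convergent convergent_def by blast
  have "norm (X k - L) \<le> 4 * (1/2) ^ k" if "k \<ge> m" for k
  proof -
    have "(\<lambda>l. norm (X l - X k)) \<longlonglongrightarrow> norm (L - X k)" by (intro tendsto_intros L)
    then have "norm (L - X k) \<le> 4 * (1/2) ^ k"
      by (rule LIMSEQ_le_const2) (auto intro!: exI[of _ k] bound' that)
    then show ?thesis by (simp add: norm_minus_commute)
  qed
  then show thesis using that by blast
qed

text \<open>
  Approximations with arbitrarily large index are needed because the \<open>k\<close>-th term will be hit by
  the back-and-forth construction only up to an error that decreases with \<open>k\<close>.  A sequence that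
  repeats every element of a countable dense set infinitely often has them.
\<close>

lemma separable_dense_sequence:
  assumes "separable_space (euclidean :: 'a::real_normed_vector topology)"
  obtains d :: "nat \<Rightarrow> 'a::real_normed_vector" where "\<And>u \<eta> K. \<eta> > 0 \<Longrightarrow> \<exists>k\<ge>K. norm (d k - u) < \<eta>"
proof -
  obtain S :: "'a set" where S: "countable S" "closure S = UNIV"
    using assms by (auto simp: separable_space_def)
  then have ne: "S \<noteq> {}" by auto
  have "\<exists>k\<ge>K. norm (from_nat_into S (fst (prod_decode k)) - u) < \<eta>" if eta: "\<eta> > 0" for u \<eta> K
  proof -
    have "u \<in> closure S" using S by simp
    then obtain z where z: "z \<in> S" "dist z u < \<eta>"
      using eta unfolding closure_approachable by blast
    obtain i where i: "from_nat_into S i = z" using from_nat_into_surj[OF S(1) z(1)] by blast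
    have "K \<le> prod_encode (i, K)" by (rule le_prod_encode_2)
    then show ?thesis using z i by (intro exI[of _ "prod_encode (i, K)"]) (simp add: dist_norm)
  qed
  then show thesis by (intro that[of "\<lambda>k. from_nat_into S (fst (prod_decode k))"])
qed

lemma limit_of_dense_isometric_copy:
  fixes x :: "nat \<Rightarrow> 'e::real_normed_vector" and y :: "nat \<Rightarrow> 'f::banach"
  assumes dist: "\<And>i j. norm (x i - x j) = norm (y i - y j)"
    and dense: "\<And>u \<eta>. \<eta> > 0 \<Longrightarrow> \<exists>i. norm (x i - u) < \<eta>"
  obtains v where "\<And>\<eta>. \<eta> > 0 \<Longrightarrow> \<exists>i. norm (x i - u) < \<eta> \<and> norm (y i - v) < \<eta>"
proof -
  have "\<exists>i. norm (x i - u) < 1 / Suc k" for k by (rule dense) simp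
  then obtain i where i: "\<And>k. norm (x (i k) - u) < 1 / Suc k" by metis
  have "(\<lambda>k. x (i k) - u) \<longlonglongrightarrow> 0"
  proof (rule Lim_null_comparison)
    show "\<forall>\<^sub>F k in sequentially. norm (x (i k) - u) \<le> 1 / Suc k"
      using i by (simp add: less_imp_le)
    show "(\<lambda>k. 1 / real (Suc k)) \<longlonglongrightarrow> 0" using LIMSEQ_inverse_real_of_nat by (simp add: inverse_eq_divide)
  qed
  then have lim: "(\<lambda>k. x (i k)) \<longlonglongrightarrow> u" by (simp add: LIM_zero_iff)
  then have "Cauchy (\<lambda>k. x (i k))" by (rule LIMSEQ_imp_Cauchy)
  then have "Cauchy (\<lambda>k. y (i k))" by (simp add: Cauchy_def dist_norm dist)
  then obtain v where v: "(\<lambda>k. y (i k)) \<longlonglongrightarrow> v" using Cauchy_convergent convergent_def by blast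
  have "\<exists>i. norm (x i - u) < \<eta> \<and> norm (y i - v) < \<eta>" if "\<eta> > 0" for \<eta>
  proof -
    have "\<forall>\<^sub>F k in sequentially. dist (x (i k)) u < \<eta> \<and> dist (y (i k)) v < \<eta>"
      using tendstoD[OF lim that] tendstoD[OF v that] by (rule eventually_conj)
    then show ?thesis
      using eventually_happens'[OF sequentially_bot] unfolding dist_norm by blast
  qed
  then show thesis using that by blast
qed

text \<open>
  The graph of the isometry is the closure \<open>G\<close> of the set of all pairs \<open>(x\<^sub>i, y\<^sub>i)\<close>.
  Equality of the norms of linear combinations passes to \<open>G\<close>, and combinations of three pairs
  suffice to read off that \<open>G\<close> is single-valued, injective, additive, homogeneous and isometric.
  It is total in both directions because a sequence of \<open>x\<^sub>i\<close> is Cauchy exactly when the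
  corresponding sequence of \<open>y\<^sub>i\<close> is.
\<close>

lemma isometry_of_dense_sequences:
  fixes s :: "'k::real_normed_field \<Rightarrow> 'e::banach \<Rightarrow> 'e" and t :: "'k \<Rightarrow> 'f::banach \<Rightarrow> 'f"
    and x :: "nat \<Rightarrow> 'e" and y :: "nat \<Rightarrow> 'f"
  assumes s: "scaled_normed_space s" and t: "scaled_normed_space t"
    and eq: "\<And>n a. norm (\<Sum>i<n. s (a i) (x i)) = norm (\<Sum>i<n. t (a i) (y i))"
    and x: "\<And>u \<eta>. \<eta> > 0 \<Longrightarrow> \<exists>i. norm (x i - u) < \<eta>"
    and y: "\<And>v \<eta>. \<eta> > 0 \<Longrightarrow> \<exists>i. norm (y i - v) < \<eta>"
  shows "\<exists>h. isometry_on UNIV s norm t norm h \<and> bij h"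
proof -
  interpret s: scaled_normed_space s by (fact s)
  interpret t: scaled_normed_space t by (fact t)
  have eq3: "norm (s a (x i) + s b (x j) + s c (x l)) = norm (t a (y i) + t b (y j) + t c (y l))"
    for a b c i j l
  proof -
    define n where "n = Suc (i + j + l)"
    define w where "w p = (if p = i then a else 0) + (if p = j then b else 0) + (if p = l then c else 0)" for p
    have "s (w p) (x p) = (if p = i then s a (x p) else 0) + (if p = j then s b (x p) else 0)
        + (if p = l then s c (x p) else 0)" for p
      by (simp add: w_def s.scale_left_distrib)
    then have 1: "(\<Sum>p<n. s (w p) (x p)) = s a (x i) + s b (x j) + s c (x l)"
      by (simp add: sum.distrib n_def)
    have "t (w p) (y p) = (if p = i then t a (y p) else 0) + (if p = j then t b (y p) else 0)
        + (if p = l then t c (y p) else 0)" for p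
      by (simp add: w_def t.scale_left_distrib)
    then have 2: "(\<Sum>p<n. t (w p) (y p)) = t a (y i) + t b (y j) + t c (y l)"
      by (simp add: sum.distrib n_def)
    show ?thesis using eq[of w n] unfolding 1 2 .
  qed
  have dist: "norm (x i - x j) = norm (y i - y j)" for i j
    using eq3[of 1 i "- 1" j 0 j] by simp
  define G where "G u v \<longleftrightarrow> (\<forall>\<eta>>0. \<exists>i. norm (x i - u) < \<eta> \<and> norm (y i - v) < \<eta>)" for u v
  have total: "\<exists>v. G u v" for u
    using limit_of_dense_isometric_copy[of x y u, OF dist x] unfolding G_def by metis
  have onto: "\<exists>u. G u v" for v
    using limit_of_dense_isometric_copy[of y x v, OF dist[symmetric] y] unfolding G_def by metis
  have G3: "norm (s a u1 + s b u2 + s c u3) = norm (t a v1 + t b v2 + t c v3)"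
    if G: "G u1 v1" "G u2 v2" "G u3 v3" for a b c u1 u2 u3 v1 v2 v3
  proof -
    define r where "r = norm a + norm b + norm c"
    have "\<bar>norm (s a u1 + s b u2 + s c u3) - norm (t a v1 + t b v2 + t c v3)\<bar> \<le> 0 + \<eta>"
      if "\<eta> > 0" for \<eta>
    proof -
      define \<theta> where "\<theta> = \<eta> / (2 * (r + 1))"
      have r0: "r \<ge> 0" by (simp add: r_def)
      then have th: "\<theta> > 0" "2 * (r * \<theta>) \<le> \<eta>" using that by (auto simp: \<theta>_def field_simps)
      obtain i j l where i: "norm (x i - u1) < \<theta>" "norm (y i - v1) < \<theta>"
        and j: "norm (x j - u2) < \<theta>" "norm (y j - v2) < \<theta>"
        and l: "norm (x l - u3) < \<theta>" "norm (y l - v3) < \<theta>"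
        using G th(1) unfolding G_def by metis
      have tri: "norm (p1 + p2 + p3) \<le> r * \<theta>"
        if "norm p1 \<le> norm a * \<theta>" "norm p2 \<le> norm b * \<theta>" "norm p3 \<le> norm c * \<theta>"
        for p1 p2 p3 :: "'z::real_normed_vector"
        using that norm_triangle_ineq[of "p1 + p2" p3] norm_triangle_ineq[of p1 p2]
        by (simp add: r_def distrib_right)
      have "norm (s a (x i - u1) + s b (x j - u2) + s c (x l - u3)) \<le> r * \<theta>"
        using i j l by (intro tri) (auto simp: s.norm_scale intro: mult_left_mono)
      then have 1: "norm ((s a (x i) + s b (x j) + s c (x l)) - (s a u1 + s b u2 + s c u3)) \<le> r * \<theta>"
        by (simp add: s.scale_right_diff_distrib algebra_simps)
      have "norm (t a (y i - v1) + t b (y j - v2) + t c (y l - v3)) \<le> r * \<theta>"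
        using i j l by (intro tri) (auto simp: t.norm_scale intro: mult_left_mono)
      then have 2: "norm ((t a (y i) + t b (y j) + t c (y l)) - (t a v1 + t b v2 + t c v3)) \<le> r * \<theta>"
        by (simp add: t.scale_right_diff_distrib algebra_simps)
      show ?thesis
        using norm_triangle_ineq3[of "s a (x i) + s b (x j) + s c (x l)" "s a u1 + s b u2 + s c u3"]
          norm_triangle_ineq3[of "t a (y i) + t b (y j) + t c (y l)" "t a v1 + t b v2 + t c v3"]
          1 2 th(2) eq3[of a i b j c l] by linarith
    qed
    then have "\<bar>norm (s a u1 + s b u2 + s c u3) - norm (t a v1 + t b v2 + t c v3)\<bar> \<le> 0"
      by (rule field_le_epsilon)
    then show ?thesis by simp
  qed
  obtain h where h: "\<And>u. G u (h u)" using total by metis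
  have add: "h (u + u') = h u + h u'" for u u'
    using G3[OF h[of u] h[of u'] h[of "u + u'"], of 1 1 "- 1"] by simp
  have scale: "h (s c u) = t c (h u)" for c u
    using G3[OF h[of u] h[of "s c u"] h[of u], of c "- 1" 0] by simp
  have norm: "norm (h u) = norm u" for u
    using G3[OF h[of u] h[of u] h[of u], of 1 0 0] by simp
  have "inj h"
  proof (rule injI)
    fix u u' assume "h u = h u'"
    then have "norm (u - u') = 0"
      using G3[OF h[of u] h[of u'] h[of u], of 1 "- 1" 0] by simp
    then show "u = u'" by simp
  qed
  moreover have "surj h"
    unfolding surj_def
  proof
    fix v
    obtain u where u: "G u v" using onto by blast
    have "v = h u" using G3[OF u h[of u] u, of 1 "- 1" 0] by simp
    then show "\<exists>u. v = h u" by blast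
  qed
  ultimately show ?thesis
    using add scale norm by (auto simp: isometry_on_def linear_map_on_def bij_def)
qed

section \<open>The back-and-forth construction and uniqueness\<close>

text \<open>
  Round \<open>k\<close> starts from tuples of length \<open>2 k\<close> whose norms agree up to \<open>2\<^sup>-\<^sup>k\<close>, and adds
  the \<open>k\<close>-th terms of dense sequences at the positions \<open>2 k\<close> (up to the same error scale)
  and \<open>2 k + 1\<close>.  Old entries move by at most \<open>2 * 2\<^sup>-\<^sup>k\<close>, so they converge, the total
  displacement after round \<open>k\<close> tends to \<open>0\<close>, and the limits inherit the density and satisfy
  the equality of norms exactly.
\<close>

lemma back_and_forth:
  fixes s :: "'k::{real_normed_field,heine_borel} \<Rightarrow> 'e::banach \<Rightarrow> 'e"
    and t :: "'k \<Rightarrow> 'f::banach \<Rightarrow> 'f"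
  assumes s: "gurarii s" and t: "gurarii t"
  obtains x :: "nat \<Rightarrow> 'e" and y :: "nat \<Rightarrow> 'f" where
    "\<And>n a. norm (\<Sum>i<n. s (a i) (x i)) = norm (\<Sum>i<n. t (a i) (y i))"
    "\<And>u \<eta>. \<eta> > 0 \<Longrightarrow> \<exists>i. norm (x i - u) < \<eta>"
    "\<And>v \<eta>. \<eta> > 0 \<Longrightarrow> \<exists>i. norm (y i - v) < \<eta>"
proof -
  interpret s: scaled_normed_space s using s by (simp add: gurarii_def)
  interpret t: scaled_normed_space t using t by (simp add: gurarii_def)
  obtain d :: "nat \<Rightarrow> 'e" where d: "\<And>u \<eta> K. \<eta> > 0 \<Longrightarrow> \<exists>k\<ge>K. norm (d k - u) < \<eta>"
    using separable_dense_sequence s unfolding gurarii_def by blast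
  obtain d' :: "nat \<Rightarrow> 'f" where d': "\<And>u \<eta> K. \<eta> > 0 \<Longrightarrow> \<exists>k\<ge>K. norm (d' k - u) < \<eta>"
    using separable_dense_sequence t unfolding gurarii_def by blast
  define P where "P k p \<longleftrightarrow> almost_equal_norms s t (2 * k) ((1/2) ^ k) (fst p) (snd p)" for k p
  define Q where "Q k p q \<longleftrightarrow>
      (\<forall>i<2 * k. norm (fst q i - fst p i) \<le> 2 * (1/2) ^ k \<and> norm (snd q i - snd p i) \<le> 2 * (1/2) ^ k) \<and>
      norm (fst q (2 * k) - d k) \<le> 2 * (1/2) ^ k \<and> snd q (Suc (2 * k)) = d' k"
    for k and p q :: "(nat \<Rightarrow> 'e) \<times> (nat \<Rightarrow> 'f)"
  have "\<exists>f. \<forall>k. P k (f k) \<and> Q k (f k) (f (Suc k))"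
  proof (rule dependent_nat_choice)
    show "\<exists>p. P 0 p" by (simp add: P_def almost_equal_norms_def)
    fix p k assume "P k p"
    then have close: "almost_equal_norms s t (2 * k) ((1/2) ^ k) (fst p) (snd p)" by (simp add: P_def)
    show "\<exists>q. P (Suc k) q \<and> Q k p q"
      by (rule back_and_forth_step[OF s t close, of "(1/2) ^ Suc k" "d k" "d' k"])
        (auto simp: P_def Q_def)
  qed
  then obtain f where P: "\<And>k. P k (f k)" and Q: "\<And>k. Q k (f k) (f (Suc k))" by blast
  \<comment> \<open>The entry \<open>i\<close> is added in round \<open>i div 2\<close> and is meaningful from \<open>f (Suc (i div 2))\<close> on.\<close>
  have step: "norm (fst (f (Suc k)) i - fst (f k) i) \<le> 2 * (1/2) ^ k"
    "norm (snd (f (Suc k)) i - snd (f k) i) \<le> 2 * (1/2) ^ k" if "k \<ge> Suc (i div 2)" for i k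
  proof -
    have "i < 2 * k" using that by presburger
    then show "norm (fst (f (Suc k)) i - fst (f k) i) \<le> 2 * (1/2) ^ k"
      "norm (snd (f (Suc k)) i - snd (f k) i) \<le> 2 * (1/2) ^ k"
      using Q[of k] unfolding Q_def by blast+
  qed
  have "\<exists>L. \<forall>k\<ge>Suc (i div 2). norm (fst (f k) i - L) \<le> 4 * (1/2) ^ k" for i
    by (rule geometric_steps_limit[of "Suc (i div 2)" "\<lambda>k. fst (f k) i"]) (use step in blast)+
  then obtain x where x: "\<And>i k. k \<ge> Suc (i div 2) \<Longrightarrow> norm (fst (f k) i - x i) \<le> 4 * (1/2) ^ k"
    by metis
  have "\<exists>L. \<forall>k\<ge>Suc (i div 2). norm (snd (f k) i - L) \<le> 4 * (1/2) ^ k" for i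
    by (rule geometric_steps_limit[of "Suc (i div 2)" "\<lambda>k. snd (f k) i"]) (use step in blast)+
  then obtain y where y: "\<And>i k. k \<ge> Suc (i div 2) \<Longrightarrow> norm (snd (f k) i - y i) \<le> 4 * (1/2) ^ k"
    by metis
  have xd: "norm (x (2 * k) - d k) \<le> 4 * (1/2) ^ k" for k
  proof -
    have "norm (fst (f (Suc k)) (2 * k) - x (2 * k)) \<le> 2 * (1/2) ^ k" using x[of "2 * k" "Suc k"] by simp
    moreover have "norm (fst (f (Suc k)) (2 * k) - d k) \<le> 2 * (1/2) ^ k" using Q[of k] by (simp add: Q_def)
    ultimately show ?thesis
      using norm_triangle_ineq4[of "fst (f (Suc k)) (2 * k) - d k" "fst (f (Suc k)) (2 * k) - x (2 * k)"]
      by simp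
  qed
  have yd: "norm (y (Suc (2 * k)) - d' k) \<le> 4 * (1/2) ^ k" for k
  proof -
    have "norm (snd (f (Suc k)) (Suc (2 * k)) - y (Suc (2 * k))) \<le> 2 * (1/2) ^ k"
      using y[of "Suc (2 * k)" "Suc k"] by simp
    moreover have "snd (f (Suc k)) (Suc (2 * k)) = d' k" using Q[of k] by (simp add: Q_def)
    moreover have "(0::real) \<le> (1/2) ^ k" by simp
    ultimately show ?thesis by (simp only: norm_minus_commute[of "d' k"])
  qed
  have small: "\<exists>K. \<forall>k\<ge>K. 4 * (1/2) ^ k < \<eta>" if "\<eta> > 0" for \<eta> :: real
  proof -
    obtain K where K: "(1/2) ^ K < \<eta> / 4"
      using real_arch_pow_inv[of "\<eta> / 4" "1/2"] \<open>\<eta> > 0\<close> by auto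
    have "4 * (1/2) ^ k < \<eta>" if "k \<ge> K" for k
    proof -
      have "(1/2) ^ k \<le> (1/2 :: real) ^ K" by (rule power_decreasing[OF that]) auto
      then show ?thesis using K by linarith
    qed
    then show ?thesis by blast
  qed
  show thesis
  proof (rule that)
    fix n and a :: "nat \<Rightarrow> 'k"
    define S where "S = (\<Sum>i<n. norm (a i))"
    define X where "X = (\<Sum>i<n. s (a i) (x i))"
    define Y where "Y = (\<Sum>i<n. t (a i) (y i))"
    \<comment> \<open>Passing to the limits costs \<open>4\<close> for each of the two tuples, and round \<open>k\<close> itself \<open>1\<close>.\<close>
    have "\<bar>norm X - norm Y\<bar> \<le> 9 * (1/2) ^ k * S" if k: "k \<ge> n" for k
    proof -
      define X' where "X' = (\<Sum>i<n. s (a i) (fst (f k) i))"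
      define Y' where "Y' = (\<Sum>i<n. t (a i) (snd (f k) i))"
      have lt: "k \<ge> Suc (i div 2)" if "i < n" for i using that k by presburger
      have "norm (\<Sum>i<n. s (a i) (fst (f k) i - x i)) \<le> 4 * (1/2) ^ k * S"
        unfolding S_def using x[OF lt] by (intro s.norm_sum_scale_le_bound) auto
      then have 1: "norm (X' - X) \<le> 4 * (1/2) ^ k * S"
        by (simp add: X'_def X_def s.scale_right_diff_distrib sum_subtractf)
      have "norm (\<Sum>i<n. t (a i) (snd (f k) i - y i)) \<le> 4 * (1/2) ^ k * S"
        unfolding S_def using y[OF lt] by (intro t.norm_sum_scale_le_bound) auto
      then have 2: "norm (Y' - Y) \<le> 4 * (1/2) ^ k * S"
        by (simp add: Y'_def Y_def t.scale_right_diff_distrib sum_subtractf)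
      have "almost_equal_norms s t n ((1/2) ^ k) (fst (f k)) (snd (f k))"
        using almost_equal_norms_mono[OF s.scaled_normed_space_axioms t.scaled_normed_space_axioms]
          P[of k] k unfolding P_def by simp
      then have "\<bar>norm X' - norm Y'\<bar> \<le> (1/2) ^ k * S"
        by (simp add: almost_equal_norms_def X'_def Y'_def S_def)
      then show ?thesis
        using 1 2 norm_triangle_ineq3[of X' X] norm_triangle_ineq3[of Y' Y] by linarith
    qed
    moreover have "(\<lambda>k. 9 * (1/2) ^ k * S) \<longlonglongrightarrow> 9 * 0 * S"
      by (intro tendsto_intros LIMSEQ_power_zero) simp
    ultimately have "\<bar>norm X - norm Y\<bar> \<le> 0" by (intro LIMSEQ_le_const) auto
    then show "norm (\<Sum>i<n. s (a i) (x i)) = norm (\<Sum>i<n. t (a i) (y i))"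
      by (simp add: X_def Y_def)
  next
    fix u :: 'e and \<eta> :: real assume \<eta>: "\<eta> > 0"
    obtain K where K: "\<And>k. k \<ge> K \<Longrightarrow> 4 * (1/2) ^ k < \<eta> / 2" using small[of "\<eta> / 2"] \<eta> by auto
    obtain k where k: "k \<ge> K" "norm (d k - u) < \<eta> / 2" using d[of "\<eta> / 2"] \<eta> by auto
    have "norm (x (2 * k) - u) < \<eta>"
      using norm_triangle_ineq[of "x (2 * k) - d k" "d k - u"] xd[of k] K[OF k(1)] k(2) by simp
    then show "\<exists>i. norm (x i - u) < \<eta>" by blast
  next
    fix v :: 'f and \<eta> :: real assume \<eta>: "\<eta> > 0"
    obtain K where K: "\<And>k. k \<ge> K \<Longrightarrow> 4 * (1/2) ^ k < \<eta> / 2" using small[of "\<eta> / 2"] \<eta> by auto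
    obtain k where k: "k \<ge> K" "norm (d' k - v) < \<eta> / 2" using d'[of "\<eta> / 2"] \<eta> by auto
    have "norm (y (Suc (2 * k)) - v) < \<eta>"
      using norm_triangle_ineq[of "y (Suc (2 * k)) - d' k" "d' k - v"] yd[of k] K[OF k(1)] k(2) by simp
    then show "\<exists>i. norm (y i - v) < \<eta>" by blast
  qed
qed

lemma gurarii_unique:
  fixes s :: "'k::{real_normed_field,heine_borel} \<Rightarrow> 'e::banach \<Rightarrow> 'e"
    and t :: "'k \<Rightarrow> 'f::banach \<Rightarrow> 'f"
  assumes s: "gurarii s" and t: "gurarii t"
  shows "\<exists>h. isometry_on UNIV s norm t norm h \<and> bij h"
proof -
  have sn: "scaled_normed_space s" and tn: "scaled_normed_space t"
    using s t by (auto simp: gurarii_def)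
  show ?thesis
    by (rule back_and_forth[OF s t], rule isometry_of_dense_sequences[OF sn tn])
qed

theorem corollary1p2:
  fixes sE :: "complex \<Rightarrow> 'e::banach \<Rightarrow> 'e"
    and sF :: "complex \<Rightarrow> 'f::banach \<Rightarrow> 'f"
  shows "(gurarii (scaleR :: real \<Rightarrow> 'e \<Rightarrow> 'e) \<and> gurarii (scaleR :: real \<Rightarrow> 'f \<Rightarrow> 'f) \<longrightarrow>
            (\<exists>h :: 'e \<Rightarrow> 'f. isometry_on UNIV (scaleR :: real \<Rightarrow> 'e \<Rightarrow> 'e) norm scaleR norm h \<and> bij h))
       \<and> (gurarii sE \<and> gurarii sF \<longrightarrow>
            (\<exists>h :: 'e \<Rightarrow> 'f. isometry_on UNIV sE norm sF norm h \<and> bij h))"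
  by (intro conjI impI; elim conjE) (rule gurarii_unique; assumption)+

end
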